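(* Let $\mathcal{E}$ be a Hilbert $K(\mathcal{H})$-module and let $x, y, z, u \in \mathcal{E}$. Then the following statements are equivalent: (i) $\theta_{x, y} \| \theta_{z, u}$; (ii) there exist a sequence $\{x_n\}$ of basic vectors in $\mathcal{E}$, with $\langle x_n,x_n\rangle=\xi_n\otimes\xi_n$ for unit vectors $\xi_n\in\mathcal{H}$ ($n\in\mathbb{N}$), and some $\lambda\in\mathbb{T}$ such that $$\lim_n [\langle x_n, y \rangle \langle x, z \rangle \langle u, x_n \rangle \xi_n , \xi_n ] = \lambda \| \theta_{x, y}\| \| \theta_{z, u}\|.$$
   Context: $(\mathcal{H}, [\cdot,\cdot])$ is a complex Hilbert space and $K(\mathcal{H})$ is the $C^*$-algebra of compact linear operators on $\mathcal{H}$. A (left) Hilbert $\mathcal{A}$-module over a $C^*$-algebra $\mathcal{A}$ is a left $\mathcal{A}$-module with an $\mathcal{A}$-valued inner product $\langle\cdot,\cdot\rangle$, linear in the first variable and conjugate linear in the second, such that $\langle tx,y\rangle=t\langle x,y\rangle$ for $t\in\mathcal{A}$, $\langle x,y\rangle^*=\langle y,x\rangle$, $\langle x,x\rangle\ge 0$ with equality iff $x=0$, and which is complete for the norm $\|x\|=\|\langle x,x\rangle\|^{1/2}$. For $x,y\in\mathcal{E}$, $\theta_{x,y}:\mathcal{E}\to\mathcal{E}$ is $\theta_{x,y}(z)=\langle z,y\rangle x$, considered in the space $\mathcal{L}(\mathcal{E})$ of adjointable maps with the operator norm. For $\xi,\eta\in\mathcal{H}$, $\xi\otimes\eta$ is the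 operator $\nu\mapsto[\nu,\eta]\xi$. A projection $e\in K(\mathcal{H})$ is minimal if $eB(\mathcal{H})e=\mathbb{C}e$, equivalently $e=\xi\otimes\xi$ for a unit vector $\xi\in\mathcal{H}$. A vector $x\in\mathcal{E}$ is basic if $\langle x,x\rangle$ is a minimal projection. Norm-parallelism: for elements $x,y$ of a complex normed space, $x\|y$ means $\|x+\lambda y\|=\|x\|+\|y\|$ for some $\lambda\in\mathbb{T}=\{\alpha\in\mathbb{C}:|\alpha|=1\}$.
   Formalization: The Hilbert module E is assumed to be nonzero; for E = {0} statement (i) holds trivially while (ii) fails because there are no basic vectors. *)

theory Defs
  imports "HOL-Analysis.Analysis"
begin

section \<open>Complex normed spaces and complex Hilbert spaces\<close>

class complex_normed_vector = real_normed_vector +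
  fixes scaleC :: "complex \<Rightarrow> 'a \<Rightarrow> 'a"  (infixr \<open>*C\<close> 75)
  assumes scaleC_add_right: "a *C (x + y) = a *C x + a *C y"
    and scaleC_add_left: "(a + b) *C x = a *C x + b *C x"
    and scaleC_scaleC: "a *C (b *C x) = (a * b) *C x"
    and scaleR_scaleC: "r *\<^sub>R x = complex_of_real r *C x"
    and norm_scaleC: "norm (a *C x) = cmod a * norm x"

text \<open>The inner product is linear in the first variable. Completeness comes from \<^class>\<open>banach\<close>.\<close>

class chilbert_space = complex_normed_vector + banach +
  fixes cinner :: "'a \<Rightarrow> 'a \<Rightarrow> complex"
  assumes cinner_commute: "cinner x y = cnj (cinner y x)"
    and cinner_add_left: "cinner (x + y) z = cinner x z + cinner y z"
    and cinner_scaleC_left: "cinner (a *C x) y = a * cinner x y"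
    and cinner_self_nonneg: "0 \<le> Re (cinner x x)"
    and cinner_self_eq_zero: "cinner x x = 0 \<longleftrightarrow> x = 0"
    and norm_eq_sqrt_cinner: "norm x = sqrt (Re (cinner x x))"

definition norm_parallel :: "'a::complex_normed_vector \<Rightarrow> 'a \<Rightarrow> bool"  (infix \<open>\<parallel>\<close> 50)
  where "x \<parallel> y \<longleftrightarrow> (\<exists>c. cmod c = 1 \<and> norm (x + c *C y) = norm x + norm y)"

lemma bounded_linear_scaleC: "bounded_linear (\<lambda>x::'a::complex_normed_vector. c *C x)"
proof (rule bounded_linear_intro[where K = "cmod c"])
  show "c *C (r *\<^sub>R x) = r *\<^sub>R (c *C x)" for r and x :: 'a
    by (simp add: scaleR_scaleC scaleC_scaleC mult.commute)
qed (simp_all add: scaleC_add_right norm_scaleC mult.commute)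

lemma scaleC_one: "1 *C (x::'a::complex_normed_vector) = x"
  using scaleR_scaleC[of 1 x] by simp

lemma scaleC_minus_one: "(-1) *C (x::'a::complex_normed_vector) = - x"
  using scaleR_scaleC[of "-1" x] by simp

lemma cinner_add_right: "cinner (x::'a::chilbert_space) (y + z) = cinner x y + cinner x z"
  by (metis cinner_add_left cinner_commute complex_cnj_add)

lemma cinner_scaleC_right: "cinner (x::'a::chilbert_space) (a *C y) = cnj a * cinner x y"
  by (metis cinner_commute cinner_scaleC_left complex_cnj_mult)

lemma cinner_minus_left: "cinner (- (x::'a::chilbert_space)) y = - cinner x y"
  using cinner_scaleC_left[of "-1" x y] by (simp add: scaleC_minus_one)

lemma cinner_minus_right: "cinner (x::'a::chilbert_space) (- y) = - cinner x y"
  by (metis cinner_commute cinner_minus_left complex_cnj_minus)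

lemma cinner_diff_left: "cinner ((x::'a::chilbert_space) - y) z = cinner x z - cinner y z"
  using cinner_add_left[of x "- y" z] by (simp add: cinner_minus_left)

lemma cinner_diff_right: "cinner (x::'a::chilbert_space) (y - z) = cinner x y - cinner x z"
  using cinner_add_right[of x y "- z"] by (simp add: cinner_minus_right)

lemma cinner_self: "cinner (x::'a::chilbert_space) x = complex_of_real ((norm x)\<^sup>2)"
proof -
  have "Im (cinner x x) = 0"
    using arg_cong[OF cinner_commute[of x x], of Im] by simp
  then show ?thesis
    by (simp add: complex_eq_iff norm_eq_sqrt_cinner cinner_self_nonneg)
qed

lemma cinner_cauchy_schwarz: "cmod (cinner (x::'a::chilbert_space) y) \<le> norm x * norm y"
proof (cases "y = 0")
  case True
  then show ?thesis
    using cinner_scaleC_right[of x 0 "0::'a"] scaleR_scaleC[of 0 "0::'a"] by simp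
next
  case False
  define a where "a = cinner x y"
  define c where "c = a / complex_of_real ((norm y)\<^sup>2)"
  have ny: "norm y > 0" using False by simp
  have yx: "cinner y x = cnj a" unfolding a_def by (rule cinner_commute)
  have cc: "a * cnj c = complex_of_real ((cmod a)\<^sup>2 / (norm y)\<^sup>2)"
    unfolding c_def by (simp add: complex_norm_square[symmetric])
  have cc': "c * cnj a = complex_of_real ((cmod a)\<^sup>2 / (norm y)\<^sup>2)"
    unfolding c_def by (simp add: complex_norm_square[symmetric])
  have cy: "c * complex_of_real ((norm y)\<^sup>2) = a"
    unfolding c_def using ny by simp
  have "cinner (x - c *C y) (x - c *C y)
      = complex_of_real ((norm x)\<^sup>2) - cnj c * a - c * cnj a
        + cnj c * (c * complex_of_real ((norm y)\<^sup>2))"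
    unfolding cinner_diff_left cinner_diff_right cinner_scaleC_left cinner_scaleC_right
      cinner_self[of x] cinner_self[of y] yx a_def[symmetric]
    by (simp add: algebra_simps)
  also have "\<dots> = complex_of_real ((norm x)\<^sup>2 - (cmod a)\<^sup>2 / (norm y)\<^sup>2)"
    unfolding cy cc' by (simp add: algebra_simps)
  finally have "0 \<le> (norm x)\<^sup>2 - (cmod a)\<^sup>2 / (norm y)\<^sup>2"
    using cinner_self_nonneg[of "x - c *C y"] by (simp del: of_real_diff of_real_power)
  then have "(cmod a)\<^sup>2 \<le> (norm x * norm y)\<^sup>2"
    using ny by (simp add: field_simps power_mult_distrib)
  then show ?thesis
    unfolding a_def by (rule power2_le_imp_le) simp
qed


section \<open>Operators\<close>

text \<open>
  Elements of \<^typ>\<open>'a \<Rightarrow>\<^sub>L 'b\<close> are only real-linear, so complex linearity has to be required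
  separately. The complex scalars act on the values, and the norm is the operator norm.
\<close>

instantiation blinfun :: (real_normed_vector, complex_normed_vector) complex_normed_vector
begin

lift_definition scaleC_blinfun :: "complex \<Rightarrow> ('a \<Rightarrow>\<^sub>L 'b) \<Rightarrow> ('a \<Rightarrow>\<^sub>L 'b)"
  is "\<lambda>c T v. c *C T v"
  by (rule bounded_linear_compose[OF bounded_linear_scaleC])

instance
proof
  fix a b :: complex and r :: real and S T :: "'a \<Rightarrow>\<^sub>L 'b"
  show "a *C (S + T) = a *C S + a *C T"
    by transfer (simp add: scaleC_add_right)
  show "(a + b) *C S = a *C S + b *C S"
    by transfer (simp add: scaleC_add_left)
  show "a *C b *C S = (a * b) *C S"
    by transfer (simp add: scaleC_scaleC)
  show "r *\<^sub>R S = complex_of_real r *C S"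
    by transfer (simp add: scaleR_scaleC)
  have le: "norm (a *C S) \<le> cmod a * norm S" for a and S :: "'a \<Rightarrow>\<^sub>L 'b"
  proof (rule norm_blinfun_bound)
    fix v
    show "norm (blinfun_apply (a *C S) v) \<le> cmod a * norm S * norm v"
      using norm_blinfun[of S v]
      by (simp add: scaleC_blinfun.rep_eq norm_scaleC mult.assoc mult_left_mono)
  qed simp
  show "norm (a *C S) = cmod a * norm S"
  proof (cases "a = 0")
    case True
    then show ?thesis using le[of a S] by simp
  next
    case False
    have "inverse a *C a *C S = 1 *C S"
      using False by transfer (simp add: scaleC_scaleC)
    also have "\<dots> = S"
      by transfer (simp add: scaleC_one)
    finally have "norm S \<le> cmod (inverse a) * norm (a *C S)"
      using le[of "inverse a" "a *C S"] by simp
    then have "cmod a * norm S \<le> norm (a *C S)"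
      using False by (simp add: norm_inverse norm_divide field_simps)
    with le[of a S] show ?thesis by simp
  qed
qed

end

lemma bounded_linear_cinner_left: "bounded_linear (\<lambda>x::'a::chilbert_space. cinner x y)"
proof (rule bounded_linear_intro[where K = "norm y"])
  show "cinner (r *\<^sub>R x) y = r *\<^sub>R cinner x y" for r x
    by (simp add: scaleR_scaleC cinner_scaleC_left scaleR_conv_of_real)
qed (simp_all add: cinner_add_left cinner_cauchy_schwarz)

lemma bounded_linear_scaleC_left: "bounded_linear (\<lambda>c. c *C (x::'a::complex_normed_vector))"
proof (rule bounded_linear_intro[where K = "norm x"])
  show "(r *\<^sub>R c) *C x = r *\<^sub>R (c *C x)" for r c
    by (simp add: scaleR_scaleC scaleC_scaleC scaleR_conv_of_real)
qed (simp_all add: scaleC_add_left norm_scaleC)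

lift_definition rank_one :: "'h::chilbert_space \<Rightarrow> 'h \<Rightarrow> ('h \<Rightarrow>\<^sub>L 'h)"  (infix \<open>\<otimes>\<close> 75)
  is "\<lambda>\<xi> \<eta> \<nu>. cinner \<nu> \<eta> *C \<xi>"
  by (rule bounded_linear_compose[OF bounded_linear_scaleC_left bounded_linear_cinner_left])

definition bounded_ops :: "('h::chilbert_space \<Rightarrow>\<^sub>L 'h) set"
  where "bounded_ops = {T :: 'h \<Rightarrow>\<^sub>L 'h. \<forall>c \<xi>. T (c *C \<xi>) = c *C T \<xi>}"

definition compact_ops :: "('h::chilbert_space \<Rightarrow>\<^sub>L 'h) set"
  where "compact_ops = {T \<in> bounded_ops. compact (closure (blinfun_apply T ` cball 0 1))}"

text \<open>\<open>is_adjoint S T\<close> says that \<open>T\<close> is the Hilbert space adjoint of \<open>S\<close>.\<close>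

definition is_adjoint :: "('h::chilbert_space \<Rightarrow>\<^sub>L 'h) \<Rightarrow> ('h \<Rightarrow>\<^sub>L 'h) \<Rightarrow> bool"
  where "is_adjoint S T \<longleftrightarrow> (\<forall>\<xi> \<eta>. cinner (S \<xi>) \<eta> = cinner \<xi> (T \<eta>))"

definition positive_op :: "('h::chilbert_space \<Rightarrow>\<^sub>L 'h) \<Rightarrow> bool"
  where "positive_op T \<longleftrightarrow> (\<forall>\<xi>. Im (cinner (T \<xi>) \<xi>) = 0 \<and> 0 \<le> Re (cinner (T \<xi>) \<xi>))"

text \<open>
  A minimal projection is nonzero by convention; \<open>e = 0\<close> satisfies the last condition below, but
  is not of the form \<open>\<xi> \<otimes> \<xi>\<close> for a unit vector \<open>\<xi>\<close>.
\<close>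

definition minimal_projection :: "('h::chilbert_space \<Rightarrow>\<^sub>L 'h) \<Rightarrow> bool"
  where "minimal_projection e \<longleftrightarrow>
    e \<in> compact_ops \<and> e o\<^sub>L e = e \<and> is_adjoint e e \<and> e \<noteq> 0 \<and>
    {e o\<^sub>L T o\<^sub>L e |T. T \<in> bounded_ops} = {c *C e |c. True}"


section \<open>Hilbert modules over the compact operators\<close>

text \<open>
  The module is a complex Banach space whose norm is the one induced by the inner product, which
  incorporates the completeness requirement. \<open>act t x\<close> is \<open>t x\<close> and matters only for
  \<open>t \<in> compact_ops\<close>. Conjugate linearity of \<open>ip\<close> in the second variable follows from \<open>ip_adjoint\<close>.
\<close>

locale hilbert_K_module =
  fixes act :: "('h::chilbert_space \<Rightarrow>\<^sub>L 'h) \<Rightarrow> 'e::{complex_normed_vector, banach} \<Rightarrow> 'e"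
    and ip :: "'e \<Rightarrow> 'e \<Rightarrow> ('h \<Rightarrow>\<^sub>L 'h)"
  assumes act_add_right: "t \<in> compact_ops \<Longrightarrow> act t (x + y) = act t x + act t y"
    and act_add_left: "\<lbrakk>s \<in> compact_ops; t \<in> compact_ops\<rbrakk> \<Longrightarrow> act (s + t) x = act s x + act t x"
    and act_act: "\<lbrakk>s \<in> compact_ops; t \<in> compact_ops\<rbrakk> \<Longrightarrow> act (s o\<^sub>L t) x = act s (act t x)"
    and act_scaleC_left: "t \<in> compact_ops \<Longrightarrow> act (c *C t) x = c *C act t x"
    and act_scaleC_right: "t \<in> compact_ops \<Longrightarrow> act t (c *C x) = c *C act t x"
    and ip_compact: "ip x y \<in> compact_ops"
    and ip_add_left: "ip (x + y) z = ip x z + ip y z"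
    and ip_scaleC_left: "ip (c *C x) y = c *C ip x y"
    and ip_act: "t \<in> compact_ops \<Longrightarrow> ip (act t x) y = t o\<^sub>L ip x y"
    and ip_adjoint: "is_adjoint (ip x y) (ip y x)"
    and ip_positive: "positive_op (ip x x)"
    and ip_eq_zero: "ip x x = 0 \<longleftrightarrow> x = 0"
    and norm_eq_sqrt_ip: "norm x = sqrt (norm (ip x x))"

definition basic_vector :: "('e \<Rightarrow> 'e \<Rightarrow> ('h::chilbert_space \<Rightarrow>\<^sub>L 'h)) \<Rightarrow> 'e \<Rightarrow> bool"
  where "basic_vector ip x \<longleftrightarrow> minimal_projection (ip x x)"

text \<open>
  Adjointable maps; in a Hilbert module they are automatically bounded and complex linear, so
  they can be viewed as a subspace of \<^typ>\<open>'e \<Rightarrow>\<^sub>L 'e\<close>, with the same norm.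
\<close>

definition adjointable_ops ::
  "('e \<Rightarrow> 'e \<Rightarrow> ('h::chilbert_space \<Rightarrow>\<^sub>L 'h)) \<Rightarrow> ('e::complex_normed_vector \<Rightarrow>\<^sub>L 'e) set"
  where "adjointable_ops ip = {T :: 'e \<Rightarrow>\<^sub>L 'e. \<exists>S :: 'e \<Rightarrow>\<^sub>L 'e. \<forall>x y. ip (T x) y = ip x (S y)}"

text \<open>
  \<^const>\<open>Blinfun\<close> is meaningful only on bounded linear maps; see \<open>theta_apply\<close> and
  \<open>theta_adjointable\<close> below.
\<close>

definition theta ::
  "(('h::chilbert_space \<Rightarrow>\<^sub>L 'h) \<Rightarrow> 'e::{complex_normed_vector, banach} \<Rightarrow> 'e) \<Rightarrow>
   ('e \<Rightarrow> 'e \<Rightarrow> ('h \<Rightarrow>\<^sub>L 'h)) \<Rightarrow> 'e \<Rightarrow> 'e \<Rightarrow> ('e \<Rightarrow>\<^sub>L 'e)"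
  where "theta act ip x y = Blinfun (\<lambda>z. act (ip z y) x)"

lemma is_adjoint_sym: "is_adjoint S T \<Longrightarrow> is_adjoint T S"
  unfolding is_adjoint_def
proof (intro allI)
  fix \<xi> \<eta>
  assume "\<forall>\<xi> \<eta>. cinner (S \<xi>) \<eta> = cinner \<xi> (T \<eta>)"
  then have "cnj (cinner (S \<eta>) \<xi>) = cnj (cinner \<eta> (T \<xi>))" by simp
  then show "cinner (T \<xi>) \<eta> = cinner \<xi> (S \<eta>)"
    unfolding cinner_commute[symmetric] by (rule sym)
qed

lemma is_adjoint_unique:
  assumes "is_adjoint S T" "is_adjoint S T'" shows "T = T'"
proof (rule blinfun_eqI)
  fix \<eta>
  have "cinner \<xi> (T \<eta>) = cinner \<xi> (T' \<eta>)" for \<xi>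
    using assms[unfolded is_adjoint_def, THEN spec, THEN spec, of \<xi> \<eta>] by simp
  then have "cinner (T \<eta> - T' \<eta>) (T \<eta> - T' \<eta>) = 0"
    by (simp only: cinner_diff_right[of "T \<eta> - T' \<eta>"] diff_self)
  then show "T \<eta> = T' \<eta>" by (simp add: cinner_self_eq_zero)
qed

lemma is_adjoint_norm_le:
  assumes "is_adjoint S T" shows "norm T \<le> norm S"
proof (rule norm_blinfun_bound)
  fix \<eta>
  have "(norm (T \<eta>))\<^sup>2 = cmod (cinner (S (T \<eta>)) \<eta>)"
    using assms by (simp add: is_adjoint_def cinner_self norm_power)
  also have "\<dots> \<le> norm (S (T \<eta>)) * norm \<eta>"
    by (rule cinner_cauchy_schwarz)
  also have "\<dots> \<le> norm S * norm (T \<eta>) * norm \<eta>"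
    by (intro mult_right_mono norm_blinfun) simp
  finally have "norm (T \<eta>) * norm (T \<eta>) \<le> norm (T \<eta>) * (norm S * norm \<eta>)"
    by (simp add: power2_eq_square algebra_simps)
  then show "norm (T \<eta>) \<le> norm S * norm \<eta>"
    by (cases "T \<eta> = 0") (auto simp: mult_le_cancel_left)
qed simp

lemma is_adjoint_norm: "is_adjoint S T \<Longrightarrow> norm T = norm S"
  by (rule antisym[OF is_adjoint_norm_le is_adjoint_norm_le[OF is_adjoint_sym]])

context hilbert_K_module
begin

lemma ip_add_right: "ip x (y + z) = ip x y + ip x z"
proof (rule is_adjoint_unique)
  show "is_adjoint (ip (y + z) x) (ip x (y + z))" by (rule ip_adjoint)
  show "is_adjoint (ip (y + z) x) (ip x y + ip x z)"
    using ip_adjoint[of y x] ip_adjoint[of z x]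
    by (simp add: is_adjoint_def ip_add_left blinfun.add_left cinner_add_left cinner_add_right)
qed

lemma ip_scaleC_right: "ip x (c *C y) = cnj c *C ip x y"
proof (rule is_adjoint_unique)
  show "is_adjoint (ip (c *C y) x) (ip x (c *C y))" by (rule ip_adjoint)
  show "is_adjoint (ip (c *C y) x) (cnj c *C ip x y)"
    using ip_adjoint[of y x]
    by (simp add: is_adjoint_def ip_scaleC_left scaleC_blinfun.rep_eq cinner_scaleC_left
        cinner_scaleC_right)
qed

lemma norm_ip_self: "norm (ip x x) = (norm x)\<^sup>2"
  by (simp add: norm_eq_sqrt_ip)

lemma norm_act_le:
  assumes t: "t \<in> compact_ops" shows "norm (act t x) \<le> norm t * norm x"
proof -
  have "(norm (act t x))\<^sup>2 = norm (t o\<^sub>L ip x (act t x))"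
    by (simp add: norm_ip_self[symmetric] ip_act t)
  also have "\<dots> \<le> norm t * norm (ip x (act t x))"
    by (rule norm_blinfun_compose)
  also have "norm (ip x (act t x)) = norm (t o\<^sub>L ip x x)"
    using is_adjoint_norm[OF ip_adjoint[of "act t x" x]] by (simp add: ip_act t)
  also have "norm t * norm (t o\<^sub>L ip x x) \<le> norm t * (norm t * norm (ip x x))"
    by (intro mult_left_mono norm_blinfun_compose) simp
  also have "\<dots> = (norm t * norm x)\<^sup>2"
    by (simp add: norm_ip_self power2_eq_square algebra_simps)
  finally show ?thesis
    by (rule power2_le_imp_le) simp
qed

lemma norm_ip_le: "norm (ip x y) \<le> norm x * norm y"
proof (cases "y = 0")
  case True
  have "ip x 0 = 0" using ip_add_right[of x 0 0] by simp
  with True show ?thesis by simp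
next
  case False
  then have ny: "norm y > 0" by simp
  define b where "b = ip x y"
  define b' where "b' = ip y x"
  have bc: "b \<in> compact_ops" unfolding b_def by (rule ip_compact)
  have adj: "is_adjoint b b'" unfolding b_def b'_def by (rule ip_adjoint)
  have "norm b' \<le> norm x * norm y"
  proof (rule norm_blinfun_bound)
    fix \<xi>
    define r where "r = 1 / (norm y)\<^sup>2"
    define w where "w = x + complex_of_real (- r) *C act b y"
    have y_by: "cinner (ip y (act b y) \<zeta>) \<eta> = cinner (ip y y (b' \<zeta>)) \<eta>" for \<zeta> \<eta>
    proof -
      have "cinner (ip y (act b y) \<zeta>) \<eta> = cinner \<zeta> (ip (act b y) y \<eta>)"
        using ip_adjoint[of y "act b y"] by (simp add: is_adjoint_def)
      also have "\<dots> = cinner \<zeta> (b (ip y y \<eta>))" by (simp add: ip_act bc)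
      also have "\<dots> = cinner (b' \<zeta>) (ip y y \<eta>)"
        using is_adjoint_sym[OF adj] by (simp add: is_adjoint_def)
      also have "\<dots> = cinner (ip y y (b' \<zeta>)) \<eta>"
        using ip_adjoint[of y y] by (simp add: is_adjoint_def)
      finally show ?thesis .
    qed
    have x_by: "cinner (ip x (act b y) \<xi>) \<xi> = cinner (b' \<xi>) (b' \<xi>)"
    proof -
      have "cinner (ip x (act b y) \<xi>) \<xi> = cinner \<xi> (ip (act b y) x \<xi>)"
        using ip_adjoint[of x "act b y"] by (simp add: is_adjoint_def)
      also have "\<dots> = cinner \<xi> (b (b' \<xi>))" by (simp add: ip_act bc b'_def)
      also have "\<dots> = cinner (b' \<xi>) (b' \<xi>)"
        using is_adjoint_sym[OF adj] by (simp add: is_adjoint_def)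
      finally show ?thesis .
    qed
    have by_x: "cinner (ip (act b y) x \<xi>) \<xi> = cinner (b' \<xi>) (b' \<xi>)"
      using adj by (simp add: ip_act bc b'_def[symmetric] is_adjoint_def)
    have by_by: "cinner (ip (act b y) (act b y) \<xi>) \<xi> = cinner (ip y y (b' \<xi>)) (b' \<xi>)"
    proof -
      have "cinner (ip (act b y) (act b y) \<xi>) \<xi> = cinner (ip y (act b y) \<xi>) (b' \<xi>)"
        using adj by (simp add: ip_act bc is_adjoint_def)
      then show ?thesis by (simp add: y_by)
    qed
    have "cinner (ip w w \<xi>) \<xi>
       = cinner (ip x x \<xi>) \<xi> - 2 * complex_of_real r * cinner (b' \<xi>) (b' \<xi>)
         + complex_of_real (r * r) * cinner (ip y y (b' \<xi>)) (b' \<xi>)"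
      unfolding w_def
      by (simp add: ip_add_left ip_add_right ip_scaleC_left ip_scaleC_right blinfun.add_left
          scaleC_blinfun.rep_eq cinner_add_left cinner_scaleC_left x_by by_x by_by
          scaleC_add_right algebra_simps)
    moreover have "0 \<le> Re (cinner (ip w w \<xi>) \<xi>)"
      using ip_positive[of w] by (simp add: positive_op_def)
    ultimately have 1: "0 \<le> Re (cinner (ip x x \<xi>) \<xi>) - 2 * r * (norm (b' \<xi>))\<^sup>2
         + r * r * Re (cinner (ip y y (b' \<xi>)) (b' \<xi>))"
      by (simp add: cinner_self del: of_real_power of_real_mult)
    have bd: "Re (cinner (ip v v \<zeta>) \<zeta>) \<le> (norm v)\<^sup>2 * (norm \<zeta>)\<^sup>2" for v \<zeta>
    proof -
      have "Re (cinner (ip v v \<zeta>) \<zeta>) \<le> norm (ip v v \<zeta>) * norm \<zeta>"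
        using complex_Re_le_cmod cinner_cauchy_schwarz order_trans by blast
      also have "\<dots> \<le> norm (ip v v) * norm \<zeta> * norm \<zeta>"
        by (intro mult_right_mono norm_blinfun) simp
      finally show ?thesis by (simp add: norm_ip_self power2_eq_square mult.assoc)
    qed
    have "r * r * Re (cinner (ip y y (b' \<xi>)) (b' \<xi>)) \<le> r * r * ((norm y)\<^sup>2 * (norm (b' \<xi>))\<^sup>2)"
      by (intro mult_left_mono bd) simp
    also have "\<dots> = r * (norm (b' \<xi>))\<^sup>2"
      using ny by (simp add: r_def power2_eq_square)
    finally have "r * (norm (b' \<xi>))\<^sup>2 \<le> (norm x)\<^sup>2 * (norm \<xi>)\<^sup>2"
      using 1 bd[of x \<xi>] by simp
    then have "(norm (b' \<xi>))\<^sup>2 \<le> (norm x * norm y * norm \<xi>)\<^sup>2"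
      using ny by (simp add: r_def field_simps power_mult_distrib)
    then show "norm (b' \<xi>) \<le> norm x * norm y * norm \<xi>"
      by (rule power2_le_imp_le) simp
  qed simp
  then show ?thesis
    using is_adjoint_norm[OF adj] by (simp add: b_def)
qed

lemma bounded_linear_theta: "bounded_linear (\<lambda>z. act (ip z y) x)"
proof (rule bounded_linear_intro[where K = "norm y * norm x"])
  show "act (ip (v + w) y) x = act (ip v y) x + act (ip w y) x" for v w
    by (simp add: ip_add_left act_add_left ip_compact)
  show "act (ip (r *\<^sub>R v) y) x = r *\<^sub>R act (ip v y) x" for r v
    by (simp add: scaleR_scaleC ip_scaleC_left act_scaleC_left ip_compact)
  show "norm (act (ip v y) x) \<le> norm v * (norm y * norm x)" for v
    using norm_act_le[OF ip_compact, of v y x] mult_right_mono[OF norm_ip_le[of v y], of "norm x"]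
    by (simp add: mult.assoc)
qed

lemma theta_apply: "theta act ip x y z = act (ip z y) x"
  by (simp add: theta_def bounded_linear_Blinfun_apply bounded_linear_theta)

lemma theta_adjointable: "theta act ip x y \<in> adjointable_ops ip"
proof -
  have "ip (theta act ip x y v) w = ip v (theta act ip y x w)" for v w
  proof (rule is_adjoint_unique)
    show "is_adjoint (ip (theta act ip y x w) v) (ip v (theta act ip y x w))"
      by (rule ip_adjoint)
    show "is_adjoint (ip (theta act ip y x w) v) (ip (theta act ip x y v) w)"
      using ip_adjoint[of w x] ip_adjoint[of y v]
      by (simp add: theta_apply ip_act ip_compact is_adjoint_def)
  qed
  then show ?thesis unfolding adjointable_ops_def by blast
qed

end

end

theory Submission
  imports Defs
begin

text \<open>
  For a vector \<open>\<xi>\<close> of the Hilbert space, \<open>form \<xi> a b = [\<langle>a,b\<rangle>\<xi>,\<xi>]\<close> is a positive semidefinite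
  sesquilinear form on the module. Since
  \<open>\<langle>\<theta>\<^sub>x\<^sub>,\<^sub>y v, \<theta>\<^sub>z\<^sub>,\<^sub>u v\<rangle> = \<langle>v,y\<rangle>\<langle>x,z\<rangle>\<langle>u,v\<rangle>\<close>, the limit in the theorem is that of \<open>form \<xi>\<^sub>n (S x\<^sub>n) (T x\<^sub>n)\<close>
  for \<open>S = \<theta>\<^sub>x\<^sub>,\<^sub>y\<close> and \<open>T = \<theta>\<^sub>z\<^sub>,\<^sub>u\<close>. The equivalence then holds for all bounded module maps \<open>S\<close>, \<open>T\<close>
  (\<open>norm_parallel_iff_basic_sequence\<close>), and the argument follows the one for operators on a Hilbert
  space, where basic vectors take the place of unit vectors.

  The substitute for the formula \<open>\<parallel>R\<parallel> = sup \<parallel>R \<xi>\<parallel>\<close> over unit vectors is that \<open>\<parallel>R\<parallel>\<^sup>2\<close> is the supremum of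
  \<open>form \<xi> (R b) (R b)\<close> over basic vectors \<open>b\<close> with \<open>\<langle>b,b\<rangle> = \<xi> \<otimes> \<xi>\<close> (\<open>norm_module_map_le\<close> and
  \<open>form_apply_self_le\<close>). Indeed, \<open>\<parallel>R v\<parallel>\<^sup>2 = \<parallel>\<langle>R v,R v\<rangle>\<parallel>\<close> is the supremum of the numbers \<open>form \<xi> (R v) (R v)\<close> over
  unit vectors \<open>\<xi>\<close>, because the norm of a positive operator is its numerical radius
  (\<open>norm_positive_op_le\<close>); and replacing \<open>v\<close> by \<open>(\<xi> \<otimes> \<xi>) v\<close> does not change this number, while it
  turns \<open>v\<close> into a multiple of a basic vector.

  If \<open>\<parallel>S + c T\<parallel> = \<parallel>S\<parallel> + \<parallel>T\<parallel>\<close>, basic vectors that norm \<open>S + c T\<close> satisfy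
  \<open>form (S b) (S b) + 2 Re (cnj c form (S b) (T b)) + form (T b) (T b) \<rightarrow> (\<parallel>S\<parallel> + \<parallel>T\<parallel>)\<^sup>2\<close>, which forces the middle
  term to its largest value. Conversely, if \<open>S\<close> and \<open>T\<close> are nonzero and \<open>form (S b) (T b)\<close> tends to \<open>c \<parallel>S\<parallel> \<parallel>T\<parallel>\<close>, positivity of
  the form leaves \<open>form (S b) (S b)\<close> and \<open>form (T b) (T b)\<close> no choice but to tend to \<open>\<parallel>S\<parallel>\<^sup>2\<close> and
  \<open>\<parallel>T\<parallel>\<^sup>2\<close>, and \<open>S + c T\<close> attains the norm \<open>\<parallel>S\<parallel> + \<parallel>T\<parallel>\<close> in the limit.
\<close>

section \<open>Rank-one projections and positive operators\<close>

lemma rank_one_apply: "(\<xi> \<otimes> \<eta>) \<nu> = cinner \<nu> \<eta> *C \<xi>"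
  by (simp add: rank_one.rep_eq)

lemma cinner_scaleR_left: "cinner (r *\<^sub>R x) y = complex_of_real r * cinner x y"
  by (simp add: scaleR_scaleC cinner_scaleC_left)

lemma cinner_scaleR_right: "cinner x (r *\<^sub>R y) = complex_of_real r * cinner x y"
  by (simp add: scaleR_scaleC cinner_scaleC_right)

lemma cinner_rank_one_self: "norm \<xi> = 1 \<Longrightarrow> cinner ((\<xi> \<otimes> \<xi>) \<xi>) \<xi> = 1"
  by (simp add: rank_one_apply cinner_scaleC_left cinner_self)

lemma norm_rank_one_le: "norm (\<xi> \<otimes> \<eta>) \<le> norm \<xi> * norm \<eta>"
proof (rule norm_blinfun_bound)
  show "norm ((\<xi> \<otimes> \<eta>) \<nu>) \<le> norm \<xi> * norm \<eta> * norm \<nu>" for \<nu>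
    using mult_right_mono[OF cinner_cauchy_schwarz[of \<nu> \<eta>], of "norm \<xi>"]
    by (simp add: rank_one_apply norm_scaleC mult_ac)
qed simp

lemma is_adjoint_rank_one: "is_adjoint (\<xi> \<otimes> \<eta>) (\<eta> \<otimes> \<xi>)"
  unfolding is_adjoint_def
proof (intro allI)
  fix \<mu> \<nu>
  show "cinner ((\<xi> \<otimes> \<eta>) \<mu>) \<nu> = cinner \<mu> ((\<eta> \<otimes> \<xi>) \<nu>)"
    using cinner_commute[of \<xi> \<nu>]
    by (simp add: rank_one_apply cinner_scaleC_left cinner_scaleC_right)
qed

lemma rank_one_compact: "\<xi> \<otimes> \<eta> \<in> compact_ops"
proof -
  let ?K = "(\<lambda>c. c *C \<xi>) ` cball 0 (norm \<eta>)"
  have "compact ?K"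
    by (intro compact_continuous_image linear_continuous_on bounded_linear_scaleC_left compact_cball)
  moreover have "blinfun_apply (\<xi> \<otimes> \<eta>) ` cball 0 1 \<subseteq> ?K"
  proof
    fix \<mu> assume "\<mu> \<in> blinfun_apply (\<xi> \<otimes> \<eta>) ` cball 0 1"
    then obtain \<nu> where \<nu>: "norm \<nu> \<le> 1" "\<mu> = cinner \<nu> \<eta> *C \<xi>"
      by (auto simp: rank_one_apply)
    have "cmod (cinner \<nu> \<eta>) \<le> norm \<eta>"
      using cinner_cauchy_schwarz[of \<nu> \<eta>] mult_right_mono[OF \<nu>(1), of "norm \<eta>"] by simp
    with \<nu> show "\<mu> \<in> ?K" by auto
  qed
  ultimately have "compact (closure (blinfun_apply (\<xi> \<otimes> \<eta>) ` cball 0 1))"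
    by (metis closed_closure closure_minimal compact_Int_closed compact_imp_closed inf.absorb2)
  moreover have "\<xi> \<otimes> \<eta> \<in> bounded_ops"
    by (simp add: bounded_ops_def rank_one_apply cinner_scaleC_left scaleC_scaleC)
  ultimately show ?thesis by (simp add: compact_ops_def)
qed

lemma minimal_projection_rank_one:
  assumes \<xi>: "norm \<xi> = 1" shows "minimal_projection (\<xi> \<otimes> \<xi>)"
proof -
  let ?e = "\<xi> \<otimes> \<xi>"
  have idem: "?e o\<^sub>L ?e = ?e"
    by (rule blinfun_eqI)
      (simp add: rank_one_apply scaleC_scaleC cinner_scaleC_left cinner_self \<xi>)
  have corner: "?e o\<^sub>L T o\<^sub>L ?e = cinner (T \<xi>) \<xi> *C ?e" if "T \<in> bounded_ops" for T
    using that
    by (intro blinfun_eqI)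
      (simp add: rank_one_apply bounded_ops_def cinner_scaleC_left scaleC_blinfun.rep_eq
        scaleC_scaleC mult.commute)
  have "c *C ?e \<in> {?e o\<^sub>L T o\<^sub>L ?e |T. T \<in> bounded_ops}" for c
  proof -
    have bd: "c *C ?e \<in> bounded_ops"
      by (simp add: bounded_ops_def rank_one_apply scaleC_blinfun.rep_eq cinner_scaleC_left
          scaleC_scaleC mult_ac)
    have "?e o\<^sub>L (c *C ?e) o\<^sub>L ?e = c *C ?e"
      unfolding corner[OF bd]
      using cinner_rank_one_self[OF \<xi>] by (simp add: scaleC_blinfun.rep_eq cinner_scaleC_left)
    with bd show ?thesis by (metis (mono_tags, lifting) mem_Collect_eq)
  qed
  then have "{?e o\<^sub>L T o\<^sub>L ?e |T. T \<in> bounded_ops} = {c *C ?e |c. True}"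
    using corner by blast
  moreover have "?e \<noteq> 0"
    using cinner_rank_one_self[OF \<xi>] cinner_diff_left[of 0 0 \<xi>] by auto
  ultimately show ?thesis
    by (simp add: minimal_projection_def rank_one_compact idem is_adjoint_rank_one)
qed

text \<open>
  The norm of a positive operator is at most its numerical radius. The proof tests positivity on
  \<open>\<xi> - (1/r) P \<xi>\<close>, where \<open>r\<close> bounds the quadratic form; this yields \<open>\<parallel>P \<xi>\<parallel>\<^sup>2 \<le> r \<cdot> [P \<xi>, \<xi>]\<close>.
\<close>

lemma norm_positive_op_le:
  assumes adj: "is_adjoint P P" and pos: "positive_op P" and q: "0 \<le> q"
    and bd: "\<And>\<xi>. norm \<xi> = 1 \<Longrightarrow> Re (cinner (P \<xi>) \<xi>) \<le> q"
  shows "norm P \<le> q"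
proof (rule field_le_epsilon)
  fix e :: real assume "0 < e"
  \<comment> \<open>A strictly larger bound, so that dividing by it is possible even if \<open>q = 0\<close>.\<close>
  define r where "r = q + e"
  have r: "0 < r" "q \<le> r" using q \<open>0 < e\<close> by (auto simp: r_def)
  have quad: "Re (cinner (P \<xi>) \<xi>) \<le> r * (norm \<xi>)\<^sup>2" for \<xi>
  proof (cases "\<xi> = 0")
    case True
    then show ?thesis using cinner_scaleR_right[of "P \<xi>" 0 \<xi>] by simp
  next
    case False
    define \<eta> where "\<eta> = (1 / norm \<xi>) *\<^sub>R \<xi>"
    have \<xi>: "\<xi> = norm \<xi> *\<^sub>R \<eta>" using False by (simp add: \<eta>_def)
    have "cinner (P \<xi>) \<xi> = complex_of_real ((norm \<xi>)\<^sup>2) * cinner (P \<eta>) \<eta>"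
      by (subst (1 2) \<xi>)
        (simp add: blinfun.scaleR_right cinner_scaleR_left cinner_scaleR_right power2_eq_square)
    then have "Re (cinner (P \<xi>) \<xi>) = (norm \<xi>)\<^sup>2 * Re (cinner (P \<eta>) \<eta>)"
      by (simp del: of_real_power)
    also have "\<dots> \<le> (norm \<xi>)\<^sup>2 * r"
      using bd[of \<eta>] r False by (intro mult_left_mono) (auto simp: \<eta>_def)
    finally show ?thesis by (simp add: mult.commute)
  qed
  show "norm P \<le> q + e"
    unfolding r_def[symmetric]
  proof (rule norm_blinfun_bound)
    fix \<xi>
    define \<zeta> where "\<zeta> = P \<xi>"
    define t where "t = 1 / r"
    have sym: "cinner (P \<zeta>) \<xi> = cinner \<zeta> \<zeta>"
      using adj by (simp add: is_adjoint_def \<zeta>_def)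
    have "cinner (P (\<xi> - t *\<^sub>R \<zeta>)) (\<xi> - t *\<^sub>R \<zeta>)
      = cinner (P \<xi>) \<xi> - 2 * complex_of_real t * cinner \<zeta> \<zeta> + complex_of_real (t * t) * cinner (P \<zeta>) \<zeta>"
      unfolding blinfun.diff_right blinfun.scaleR_right cinner_scaleR_left cinner_scaleR_right
        cinner_diff_left cinner_diff_right sym \<zeta>_def[symmetric]
      by (simp add: algebra_simps)
    also have "Re \<dots> = Re (cinner (P \<xi>) \<xi>) - 2 * t * (norm \<zeta>)\<^sup>2 + t * t * Re (cinner (P \<zeta>) \<zeta>)"
      by (simp add: cinner_self del: of_real_mult of_real_power)
    finally have "0 \<le> \<dots>"
      using pos unfolding positive_op_def by metis
    also have "\<dots> \<le> r * (norm \<xi>)\<^sup>2 - 2 * t * (norm \<zeta>)\<^sup>2 + t * t * (r * (norm \<zeta>)\<^sup>2)"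
      using r by (intro add_mono diff_mono mult_left_mono quad) (auto simp: t_def)
    also have "\<dots> = r * (norm \<xi>)\<^sup>2 - (norm \<zeta>)\<^sup>2 / r"
      using r by (simp add: t_def)
    finally have "(norm \<zeta>)\<^sup>2 \<le> (r * norm \<xi>)\<^sup>2"
      using r by (simp add: field_simps power2_eq_square)
    then show "norm (P \<xi>) \<le> r * norm \<xi>"
      unfolding \<zeta>_def[symmetric] by (rule power2_le_imp_le) (use r in simp)
  qed (use r in simp)
qed


section \<open>Scalar forms and basic vectors\<close>

context hilbert_K_module
begin

definition form :: "'h \<Rightarrow> 'e \<Rightarrow> 'e \<Rightarrow> complex"
  where "form \<xi> a b = cinner (ip a b \<xi>) \<xi>"

lemma form_commute: "form \<xi> b a = cnj (form \<xi> a b)"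
  using ip_adjoint[of b a] cinner_commute[of \<xi> "ip a b \<xi>"] by (simp add: form_def is_adjoint_def)

lemma form_self_nonneg: "0 \<le> Re (form \<xi> a a)"
  using ip_positive[of a] by (simp add: form_def positive_op_def)

lemma form_scaleC: "form \<xi> (c *C a) (d *C b) = c * cnj d * form \<xi> a b"
  by (simp add: form_def ip_scaleC_left ip_scaleC_right scaleC_blinfun.rep_eq cinner_scaleC_left)

lemma form_scaleR_self: "Re (form \<xi> (r *\<^sub>R a) (r *\<^sub>R a)) = r\<^sup>2 * Re (form \<xi> a a)"
  by (simp add: scaleR_scaleC form_scaleC power2_eq_square mult.assoc)

lemma ip_scaleR_self: "ip (r *\<^sub>R a) (r *\<^sub>R a) = r\<^sup>2 *\<^sub>R ip a a"
  by (simp add: scaleR_scaleC ip_scaleC_left ip_scaleC_right scaleC_scaleC power2_eq_square)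

lemma form_add_scaleC_self:
  "Re (form \<xi> (a + c *C b) (a + c *C b))
    = Re (form \<xi> a a) + 2 * Re (cnj c * form \<xi> a b) + (cmod c)\<^sup>2 * Re (form \<xi> b b)"
proof -
  have ac: "form \<xi> a (c *C b) = cnj c * form \<xi> a b"
    using form_scaleC[of \<xi> 1 a c b] by (simp add: scaleC_one)
  have "form \<xi> (a + c *C b) (a + c *C b)
      = form \<xi> a a + form \<xi> a (c *C b) + form \<xi> (c *C b) a + form \<xi> (c *C b) (c *C b)"
    by (simp add: form_def ip_add_left ip_add_right blinfun.add_left cinner_add_left)
  also have "\<dots> = form \<xi> a a + cnj c * form \<xi> a b + cnj (cnj c * form \<xi> a b)
      + complex_of_real ((cmod c)\<^sup>2) * form \<xi> b b"
    by (simp only: form_commute[of \<xi> "c *C b" a] ac form_scaleC complex_norm_square)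
  finally show ?thesis by (simp del: of_real_power)
qed

lemma norm_form_le:
  assumes "norm \<xi> = 1" shows "cmod (form \<xi> a b) \<le> norm a * norm b"
  using cinner_cauchy_schwarz[of "ip a b \<xi>" \<xi>] norm_blinfun[of "ip a b" \<xi>] norm_ip_le[of a b] assms
  by (simp add: form_def)

lemma form_self_le:
  assumes "norm \<xi> = 1" shows "Re (form \<xi> a a) \<le> (norm a)\<^sup>2"
  using norm_form_le[OF assms, of a a] complex_Re_le_cmod[of "form \<xi> a a"]
  by (simp add: power2_eq_square)

lemma ip_act_right:
  assumes "t \<in> compact_ops" "is_adjoint t t'"
  shows "ip a (act t b) = ip a b o\<^sub>L t'"
proof (rule is_adjoint_unique[OF ip_adjoint[of "act t b" a]])
  show "is_adjoint (ip (act t b) a) (ip a b o\<^sub>L t')"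
    using assms ip_adjoint[of b a] by (simp add: is_adjoint_def ip_act)
qed

text \<open>
  This is how basic vectors arise: \<open>(\<xi> \<otimes> \<xi>) a\<close> has inner square \<open>form \<xi> a a\<close> times \<open>\<xi> \<otimes> \<xi>\<close>, because
  the corner of the compact operators cut out by a minimal projection consists of scalars.
\<close>

lemma ip_compress:
  "ip (act (\<xi> \<otimes> \<xi>) a) (act (\<xi> \<otimes> \<xi>) b) = form \<xi> a b *C (\<xi> \<otimes> \<xi>)"
proof -
  have lin: "ip a b (c *C \<nu>) = c *C ip a b \<nu>" for c \<nu>
    using ip_compact[of a b] by (simp add: compact_ops_def bounded_ops_def)
  show ?thesis
    by (rule blinfun_eqI)
      (simp add: ip_act ip_act_right[OF rank_one_compact is_adjoint_rank_one] rank_one_compact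
        rank_one_apply lin cinner_scaleC_left scaleC_blinfun.rep_eq scaleC_scaleC form_def mult.commute)
qed

lemma form_compress:
  "norm \<xi> = 1 \<Longrightarrow> form \<xi> (act (\<xi> \<otimes> \<xi>) a) (act (\<xi> \<otimes> \<xi>) b) = form \<xi> a b"
  using cinner_rank_one_self[of \<xi>]
  by (simp add: form_def[of _ "act _ _"] ip_compress scaleC_blinfun.rep_eq cinner_scaleC_left)

text \<open>
  A basic vector determines \<open>\<xi>\<close> only up to a phase. The relation records one choice of \<open>\<xi>\<close>, since the
  scalar forms are evaluated at it.
\<close>

definition basic_at :: "'h \<Rightarrow> 'e \<Rightarrow> bool"
  where "basic_at \<xi> b \<longleftrightarrow> norm \<xi> = 1 \<and> ip b b = \<xi> \<otimes> \<xi>"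

lemma basic_at_iff:
  "basic_at \<xi> b \<longleftrightarrow> basic_vector ip b \<and> norm \<xi> = 1 \<and> ip b b = \<xi> \<otimes> \<xi>"
  using minimal_projection_rank_one by (auto simp: basic_at_def basic_vector_def)

lemma norm_basic_le: "basic_at \<xi> b \<Longrightarrow> norm b \<le> 1"
  using norm_rank_one_le[of \<xi> \<xi>] by (simp add: basic_at_def norm_eq_sqrt_ip)

definition module_map :: "('e \<Rightarrow>\<^sub>L 'e) \<Rightarrow> bool"
  where "module_map R \<longleftrightarrow> (\<forall>t\<in>compact_ops. \<forall>v. R (act t v) = act t (R v))"

lemma module_map_id: "module_map id_blinfun"
  by (simp add: module_map_def)

lemma module_map_add_scaleC:
  "module_map S \<Longrightarrow> module_map T \<Longrightarrow> module_map (S + c *C T)"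
  by (simp add: module_map_def blinfun.add_left scaleC_blinfun.rep_eq act_add_right act_scaleC_right)

lemma module_map_theta: "module_map (theta act ip x y)"
  by (simp add: module_map_def theta_apply ip_act act_act ip_compact)

lemma form_apply_le:
  fixes S T :: "'e \<Rightarrow>\<^sub>L 'e"
  assumes \<xi>: "norm \<xi> = 1" and b: "norm b \<le> 1"
  shows "cmod (form \<xi> (S b) (T b)) \<le> norm S * norm T"
proof -
  have le: "norm (R b) \<le> norm R" for R :: "'e \<Rightarrow>\<^sub>L 'e"
    using norm_blinfun[of R b] mult_left_mono[OF b, of "norm R"] by simp
  show ?thesis
    using norm_form_le[OF \<xi>, of "S b" "T b"] mult_mono[OF le[of S] le[of T]] by simp
qed

lemma form_apply_self_le:
  fixes R :: "'e \<Rightarrow>\<^sub>L 'e"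
  assumes "norm \<xi> = 1" "norm b \<le> 1"
  shows "Re (form \<xi> (R b) (R b)) \<le> (norm R)\<^sup>2"
  using form_apply_le[OF assms, of R R] complex_Re_le_cmod[of "form \<xi> (R b) (R b)"]
  by (simp add: power2_eq_square)

text \<open>
  Basic vectors suffice to compute the norm of a module map. A module map commutes with compression
  by \<open>\<eta> \<otimes> \<eta>\<close>, so \<open>form \<eta> (R v) (R v)\<close> may be computed at \<open>w = (\<eta> \<otimes> \<eta>) v\<close>; with \<open>p = form \<eta> v v \<le> \<parallel>v\<parallel>\<^sup>2\<close>, it
  is \<open>\<surd>p\<close> times a basic vector if \<open>p > 0\<close>, and 0 if \<open>p = 0\<close>. The numerical radius formula for \<open>\<langle>R v,R v\<rangle>\<close> does the rest.
\<close>

lemma norm_module_map_le: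
  assumes R: "module_map R" and q: "0 \<le> q"
    and bd: "\<And>\<xi> b. basic_at \<xi> b \<Longrightarrow> Re (form \<xi> (R b) (R b)) \<le> q"
  shows "(norm R)\<^sup>2 \<le> q"
proof -
  have unit: "Re (form \<eta> (R v) (R v)) \<le> q * (norm v)\<^sup>2" if \<eta>: "norm \<eta> = 1" for \<eta> v
  proof -
    define w where "w = act (\<eta> \<otimes> \<eta>) v"
    have Rw: "R w = act (\<eta> \<otimes> \<eta>) (R v)"
      using R by (simp add: w_def module_map_def rank_one_compact)
    have Rv: "form \<eta> (R v) (R v) = form \<eta> (R w) (R w)"
      by (simp add: Rw form_compress \<eta>)
    define p where "p = Re (form \<eta> v v)"
    have vv: "form \<eta> v v = complex_of_real p"
      using form_commute[of \<eta> v v] by (simp add: p_def complex_eq_iff)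
    have ww: "ip w w = p *\<^sub>R (\<eta> \<otimes> \<eta>)"
      by (simp add: w_def ip_compress vv scaleR_scaleC)
    have p: "0 \<le> p" "p \<le> (norm v)\<^sup>2"
      unfolding p_def using form_self_nonneg form_self_le[OF \<eta>] by auto
    have "Re (form \<eta> (R w) (R w)) \<le> q * p"
    proof (cases "p = 0")
      case True
      then have "ip w w = 0"
        by (simp add: ww)
      then have "R w = 0" by (simp add: ip_eq_zero blinfun.zero_right)
      then show ?thesis using form_scaleR_self[of \<eta> 0 "0 :: 'e"] True by simp
    next
      case False
      define b where "b = (1 / sqrt p) *\<^sub>R w"
      have "basic_at \<eta> b"
        using \<eta> p False by (simp add: basic_at_def b_def ip_scaleR_self ww power_divide)
      then have "(1 / sqrt p)\<^sup>2 * Re (form \<eta> (R w) (R w)) \<le> q"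
        using bd[of \<eta> b] by (simp only: b_def blinfun.scaleR_right form_scaleR_self)
      then show ?thesis using p False by (simp add: power_divide field_simps)
    qed
    also have "\<dots> \<le> q * (norm v)\<^sup>2" using p q by (intro mult_left_mono)
    finally show ?thesis by (simp only: Rv)
  qed
  have "norm R \<le> sqrt q"
  proof (rule norm_blinfun_bound)
    fix v
    have "norm (ip (R v) (R v)) \<le> q * (norm v)\<^sup>2"
      using unit q
      by (intro norm_positive_op_le ip_adjoint ip_positive) (auto simp: form_def)
    then have "(norm (R v))\<^sup>2 \<le> (sqrt q * norm v)\<^sup>2"
      using q by (simp add: norm_ip_self power_mult_distrib)
    then show "norm (R v) \<le> sqrt q * norm v"
      by (rule power2_le_imp_le) (use q in simp)
  qed (use q in simp)
  then show ?thesis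
    using q by (metis norm_ge_zero power_mono real_sqrt_pow2)
qed

text \<open>Without basic vectors the bound above would hold vacuously, even for the identity and \<open>q = 0\<close>.\<close>

lemma ex_basic:
  assumes "(w :: 'e) \<noteq> 0" shows "\<exists>\<xi> b. basic_at \<xi> b"
proof (rule ccontr)
  assume "\<nexists>\<xi> b. basic_at \<xi> b"
  then have "(norm (id_blinfun :: 'e \<Rightarrow>\<^sub>L 'e))\<^sup>2 \<le> 0"
    by (intro norm_module_map_le module_map_id) auto
  then have "(id_blinfun :: 'e \<Rightarrow>\<^sub>L 'e) = 0" by simp
  then have "w = 0" by (metis blinfun.zero_left id_blinfun.rep_eq)
  with assms show False by simp
qed

lemma ex_norming_basic_sequence:
  assumes w: "(w :: 'e) \<noteq> 0" and R: "module_map R"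
  shows "\<exists>xs \<xi>. (\<forall>n. basic_at (\<xi> n) (xs n)) \<and>
    (\<lambda>n. Re (form (\<xi> n) (R (xs n)) (R (xs n)))) \<longlonglongrightarrow> (norm R)\<^sup>2"
proof -
  have "\<exists>b \<xi>. basic_at \<xi> b \<and> (norm R)\<^sup>2 - 1 / real (Suc n) < Re (form \<xi> (R b) (R b))" for n
  proof (rule ccontr)
    assume "\<not> ?thesis"
    then have le: "\<And>\<xi> b. basic_at \<xi> b \<Longrightarrow> Re (form \<xi> (R b) (R b)) \<le> (norm R)\<^sup>2 - 1 / real (Suc n)"
      by (meson not_le_imp_less)
    \<comment> \<open>The bound is nonnegative because some basic vector satisfies it; this also covers \<open>R = 0\<close>.\<close>
    obtain \<xi> b where "basic_at \<xi> b" using ex_basic[OF w] by blast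
    then have "0 \<le> (norm R)\<^sup>2 - 1 / real (Suc n)"
      using le form_self_nonneg order_trans by blast
    then have "(norm R)\<^sup>2 \<le> (norm R)\<^sup>2 - 1 / real (Suc n)"
      by (rule norm_module_map_le[OF R _ le])
    then show False by simp
  qed
  then obtain xs \<xi> where *: "\<And>n. basic_at (\<xi> n) (xs n)"
    "\<And>n. (norm R)\<^sup>2 - 1 / real (Suc n) < Re (form (\<xi> n) (R (xs n)) (R (xs n)))"
    by metis
  have "(\<lambda>n. Re (form (\<xi> n) (R (xs n)) (R (xs n)))) \<longlonglongrightarrow> (norm R)\<^sup>2"
  proof (rule tendsto_sandwich)
    show "(\<lambda>n. (norm R)\<^sup>2 - 1 / real (Suc n)) \<longlonglongrightarrow> (norm R)\<^sup>2"
      using tendsto_diff[OF tendsto_const LIMSEQ_inverse_real_of_nat, of "(norm R)\<^sup>2"]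
      by (simp add: inverse_eq_divide)
    show "\<forall>\<^sub>F n in sequentially. Re (form (\<xi> n) (R (xs n)) (R (xs n))) \<le> (norm R)\<^sup>2"
      using *(1) norm_basic_le by (intro always_eventually allI form_apply_self_le) (auto simp: basic_at_def)
  qed (use *(2) in \<open>auto intro!: always_eventually less_imp_le\<close>)
  with *(1) show ?thesis by blast
qed


section \<open>Norm-parallelism of module maps\<close>

lemma tendsto_of_Re_tendsto_bound:
  fixes f :: "nat \<Rightarrow> complex"
  assumes bd: "\<And>n. cmod (f n) \<le> m" and lim: "(\<lambda>n. Re (f n)) \<longlonglongrightarrow> m"
  shows "f \<longlonglongrightarrow> complex_of_real m"
proof -
  have "(Im (f n))\<^sup>2 \<le> m\<^sup>2 - (Re (f n))\<^sup>2" for n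
    using power_mono[OF bd[of n], of 2] by (simp add: cmod_power2)
  moreover have "(\<lambda>n. m\<^sup>2 - (Re (f n))\<^sup>2) \<longlonglongrightarrow> m\<^sup>2 - m\<^sup>2"
    by (intro tendsto_intros lim)
  then have "(\<lambda>n. m\<^sup>2 - (Re (f n))\<^sup>2) \<longlonglongrightarrow> 0" by simp
  ultimately have "(\<lambda>n. (Im (f n))\<^sup>2) \<longlonglongrightarrow> 0"
    by - (rule tendsto_sandwich[OF always_eventually always_eventually tendsto_const], simp_all)
  then have "(\<lambda>n. sqrt ((Im (f n))\<^sup>2)) \<longlonglongrightarrow> sqrt 0"
    by (rule tendsto_real_sqrt)
  then have "(\<lambda>n. Im (f n)) \<longlonglongrightarrow> 0"
    by (simp add: tendsto_rabs_zero_iff)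
  with lim show ?thesis by (simp add: tendsto_complex_iff)
qed

text \<open>
  In the expansion of \<open>form ((S + c T) b) ((S + c T) b)\<close> the three terms are bounded by \<open>\<parallel>S\<parallel>\<^sup>2\<close>,
  \<open>2 \<parallel>S\<parallel> \<parallel>T\<parallel>\<close> and \<open>\<parallel>T\<parallel>\<^sup>2\<close>. As the sum tends to the sum of the bounds, the mixed term tends to its bound;
  its imaginary part vanishes in the limit because its modulus obeys the same bound.
\<close>

lemma tendsto_form_if_parallel:
  fixes S T :: "'e \<Rightarrow>\<^sub>L 'e"
  assumes basic: "\<And>n. basic_at (\<xi> n) (xs n)" and c: "cmod c = 1"
    and eq: "norm (S + c *C T) = norm S + norm T"
    and lim: "(\<lambda>n. Re (form (\<xi> n) ((S + c *C T) (xs n)) ((S + c *C T) (xs n))))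
      \<longlonglongrightarrow> (norm (S + c *C T))\<^sup>2"
  shows "(\<lambda>n. form (\<xi> n) (S (xs n)) (T (xs n))) \<longlonglongrightarrow> c * norm S * norm T"
proof -
  have unit: "norm (\<xi> n) = 1" "norm (xs n) \<le> 1" for n
    using basic[of n] norm_basic_le by (auto simp: basic_at_def)
  define g where "g n = cnj c * form (\<xi> n) (S (xs n)) (T (xs n))" for n
  have g: "cmod (g n) \<le> norm S * norm T" for n
    using form_apply_le[OF unit[of n], of S T] by (simp add: g_def norm_mult c)
  have expand: "Re (form (\<xi> n) ((S + c *C T) (xs n)) ((S + c *C T) (xs n)))
      \<le> (norm S)\<^sup>2 + 2 * Re (g n) + (norm T)\<^sup>2" for n
    using form_apply_self_le[OF unit[of n], of S] form_apply_self_le[OF unit[of n], of T]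
    by (simp add: blinfun.add_left scaleC_blinfun.rep_eq form_add_scaleC_self c g_def)
  have "(\<lambda>n. Re (g n)) \<longlonglongrightarrow> norm S * norm T"
  proof (rule tendsto_sandwich)
    let ?h = "\<lambda>n. (Re (form (\<xi> n) ((S + c *C T) (xs n)) ((S + c *C T) (xs n)))
        - (norm S)\<^sup>2 - (norm T)\<^sup>2) / 2"
    have "?h \<longlonglongrightarrow> ((norm (S + c *C T))\<^sup>2 - (norm S)\<^sup>2 - (norm T)\<^sup>2) / 2"
      by (intro tendsto_intros lim) simp
    then show "?h \<longlonglongrightarrow> norm S * norm T"
      unfolding eq by (simp add: power2_sum)
    show "\<forall>\<^sub>F n in sequentially. ?h n \<le> Re (g n)"
    proof (intro always_eventually allI)
      show "?h n \<le> Re (g n)" for n using expand[of n] by simp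
    qed
    show "\<forall>\<^sub>F n in sequentially. Re (g n) \<le> norm S * norm T"
      using g complex_Re_le_cmod order_trans by (blast intro: always_eventually)
  qed simp
  then have "g \<longlonglongrightarrow> complex_of_real (norm S * norm T)"
    by (rule tendsto_of_Re_tendsto_bound[OF g])
  then have "(\<lambda>n. c * g n) \<longlonglongrightarrow> c * complex_of_real (norm S * norm T)"
    by (rule tendsto_mult_left)
  moreover have "c * cnj c = 1"
    using complex_norm_square[of c] c by simp
  then have "c * g n = form (\<xi> n) (S (xs n)) (T (xs n))" for n
    by (simp add: g_def flip: mult.assoc)
  ultimately show ?thesis by (simp add: mult.assoc)
qed

text \<open>
  With \<open>s = \<parallel>S\<parallel>\<close>, \<open>t = \<parallel>T\<parallel>\<close> and \<open>g = Re (cnj c form (S b) (T b))\<close>, positivity of the form at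
  \<open>S b - (s/t) c T b\<close> bounds \<open>A = form (S b) (S b)\<close> and \<open>B = form (T b) (T b)\<close> from below in terms of \<open>g\<close>.
  For nonzero \<open>S\<close> and \<open>T\<close>, \<open>A + 2 g + B\<close>, which is at most \<open>\<parallel>S + c T\<parallel>\<^sup>2\<close>, is at least an affine function of \<open>g\<close> with value
  \<open>(s + t)\<^sup>2\<close> at \<open>g = s t\<close>.
\<close>

lemma norm_add_eq_if_tendsto_form:
  fixes S T :: "'e \<Rightarrow>\<^sub>L 'e"
  assumes basic: "\<And>n. basic_at (\<xi> n) (xs n)" and c: "cmod c = 1"
    and lim: "(\<lambda>n. form (\<xi> n) (S (xs n)) (T (xs n))) \<longlonglongrightarrow> c * norm S * norm T"
  shows "norm (S + c *C T) = norm S + norm T"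
proof (cases "S = 0 \<or> T = 0")
  case True
  then show ?thesis
    using c norm_scaleC[of c T] norm_scaleC[of c "0 :: 'e \<Rightarrow>\<^sub>L 'e"] by auto
next
  case False
  define s t where "s = norm S" and "t = norm T"
  have st: "0 < s" "0 < t" using False by (auto simp: s_def t_def)
  have unit: "norm (\<xi> n) = 1" "norm (xs n) \<le> 1" for n
    using basic[of n] norm_basic_le by (auto simp: basic_at_def)
  define g where "g n = Re (cnj c * form (\<xi> n) (S (xs n)) (T (xs n)))" for n
  have "(\<lambda>n. Re (cnj c * form (\<xi> n) (S (xs n)) (T (xs n)))) \<longlonglongrightarrow> Re (cnj c * (c * norm S * norm T))"
    by (intro tendsto_intros lim)
  moreover have "cnj c * c = 1"
    using complex_norm_square[of c] c by (simp add: mult.commute)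
  then have "cnj c * (c * norm S * norm T) = complex_of_real (s * t)"
    by (simp add: s_def t_def flip: mult.assoc)
  ultimately have g: "g \<longlonglongrightarrow> s * t"
    by (simp add: g_def[abs_def])
  \<comment> \<open>The slope of the affine lower bound: \<open>2 s/t\<close> from \<open>A\<close>, \<open>2 t/s\<close> from \<open>B\<close> and 2 from the mixed term.\<close>
  define K where "K = 2 + 2 * (s / t) + 2 * (t / s)"
  have low: "K * g n - s\<^sup>2 - t\<^sup>2 \<le> (norm (S + c *C T))\<^sup>2" for n
  proof -
    define A B where "A = Re (form (\<xi> n) (S (xs n)) (S (xs n)))"
      and "B = Re (form (\<xi> n) (T (xs n)) (T (xs n)))"
    have le: "A \<le> s\<^sup>2" "B \<le> t\<^sup>2"
      unfolding A_def B_def s_def t_def using form_apply_self_le[OF unit[of n]] by auto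
    define r where "r = s / t"
    have r: "0 < r" "s = r * t" using st by (auto simp: r_def)
    have "0 \<le> Re (form (\<xi> n) (S (xs n) + (- complex_of_real r * c) *C T (xs n))
        (S (xs n) + (- complex_of_real r * c) *C T (xs n)))"
      by (rule form_self_nonneg)
    also have "\<dots> = A - 2 * r * g n + r\<^sup>2 * B"
      unfolding form_add_scaleC_self
      by (simp add: A_def B_def g_def norm_mult c r mult.assoc algebra_simps)
    finally have key: "2 * r * g n \<le> A + r\<^sup>2 * B" by simp
    have "r\<^sup>2 * B \<le> r\<^sup>2 * t\<^sup>2" using le by (intro mult_left_mono) auto
    moreover have "s\<^sup>2 = r\<^sup>2 * t\<^sup>2" using r(2) by (simp add: power_mult_distrib)
    ultimately have A: "2 * r * g n - s\<^sup>2 \<le> A" using key by linarith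
    have "r\<^sup>2 * (2 * (t / s) * g n - t\<^sup>2) = 2 * r * g n - s\<^sup>2"
      using st by (simp add: r_def power2_eq_square field_simps)
    with key le have "r\<^sup>2 * (2 * (t / s) * g n - t\<^sup>2) \<le> r\<^sup>2 * B" by linarith
    then have B: "2 * (t / s) * g n - t\<^sup>2 \<le> B" using r by simp
    have "K * g n - s\<^sup>2 - t\<^sup>2 \<le> A + 2 * g n + B"
      using A B by (simp add: K_def r_def algebra_simps)
    also have "\<dots> = Re (form (\<xi> n) ((S + c *C T) (xs n)) ((S + c *C T) (xs n)))"
      by (simp add: A_def B_def g_def blinfun.add_left scaleC_blinfun.rep_eq form_add_scaleC_self c)
    also have "\<dots> \<le> (norm (S + c *C T))\<^sup>2"
      by (rule form_apply_self_le[OF unit[of n]])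
    finally show ?thesis .
  qed
  have "(\<lambda>n. K * g n - s\<^sup>2 - t\<^sup>2) \<longlonglongrightarrow> K * (s * t) - s\<^sup>2 - t\<^sup>2"
    by (intro tendsto_intros g)
  then have "K * (s * t) - s\<^sup>2 - t\<^sup>2 \<le> (norm (S + c *C T))\<^sup>2"
    by (rule LIMSEQ_le_const2) (use low in blast)
  moreover have "K * (s * t) - s\<^sup>2 - t\<^sup>2 = (s + t)\<^sup>2"
    using st by (simp add: K_def field_simps power2_eq_square)
  ultimately have "(s + t)\<^sup>2 \<le> (norm (S + c *C T))\<^sup>2" by (simp only:)
  then have "s + t \<le> norm (S + c *C T)"
    by (rule power2_le_imp_le) (rule norm_ge_zero)
  moreover have "norm (S + c *C T) \<le> s + t"
    using norm_triangle_ineq[of S "c *C T"] c by (simp add: norm_scaleC s_def t_def)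
  ultimately show ?thesis by (simp add: s_def t_def)
qed

theorem norm_parallel_iff_basic_sequence:
  assumes w: "(w :: 'e) \<noteq> 0" and S: "module_map S" and T: "module_map T"
  shows "S \<parallel> T \<longleftrightarrow> (\<exists>xs \<xi> c. (\<forall>n. basic_at (\<xi> n) (xs n)) \<and> cmod c = 1 \<and>
    (\<lambda>n. form (\<xi> n) (S (xs n)) (T (xs n))) \<longlonglongrightarrow> c * norm S * norm T)"
proof
  assume "S \<parallel> T"
  then obtain c where c: "cmod c = 1" "norm (S + c *C T) = norm S + norm T"
    by (auto simp: norm_parallel_def)
  obtain xs \<xi> where "\<forall>n. basic_at (\<xi> n) (xs n)"
    "(\<lambda>n. Re (form (\<xi> n) ((S + c *C T) (xs n)) ((S + c *C T) (xs n)))) \<longlonglongrightarrow> (norm (S + c *C T))\<^sup>2"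
    using ex_norming_basic_sequence[OF w module_map_add_scaleC[OF S T]] by blast
  with c tendsto_form_if_parallel show "\<exists>xs \<xi> c. (\<forall>n. basic_at (\<xi> n) (xs n)) \<and> cmod c = 1 \<and>
    (\<lambda>n. form (\<xi> n) (S (xs n)) (T (xs n))) \<longlonglongrightarrow> c * norm S * norm T"
    by blast
next
  assume "\<exists>xs \<xi> c. (\<forall>n. basic_at (\<xi> n) (xs n)) \<and> cmod c = 1 \<and>
    (\<lambda>n. form (\<xi> n) (S (xs n)) (T (xs n))) \<longlonglongrightarrow> c * norm S * norm T"
  then show "S \<parallel> T"
    unfolding norm_parallel_def using norm_add_eq_if_tendsto_form by blast
qed

lemma form_theta:
  "form \<xi> (theta act ip x y v) (theta act ip z u v)
    = cinner ((ip v y o\<^sub>L ip x z o\<^sub>L ip u v) \<xi>) \<xi>"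
  by (simp add: form_def theta_apply ip_act ip_act_right[OF ip_compact ip_adjoint] ip_compact)

end

theorem corollary3p3:
  fixes act :: "('h::chilbert_space \<Rightarrow>\<^sub>L 'h) \<Rightarrow> 'e::{complex_normed_vector, banach} \<Rightarrow> 'e"
    and ip :: "'e \<Rightarrow> 'e \<Rightarrow> ('h \<Rightarrow>\<^sub>L 'h)"
    and x y z u :: 'e
  assumes "hilbert_K_module act ip"
    and nonzero: "\<exists>w::'e. w \<noteq> 0"
  shows "theta act ip x y \<parallel> theta act ip z u \<longleftrightarrow>
    (\<exists>(xs :: nat \<Rightarrow> 'e) (\<xi> :: nat \<Rightarrow> 'h) (c :: complex).
        (\<forall>n. basic_vector ip (xs n) \<and> norm (\<xi> n) = 1 \<and> ip (xs n) (xs n) = \<xi> n \<otimes> \<xi> n) \<and>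
        cmod c = 1 \<and>
        (\<lambda>n. cinner ((ip (xs n) y o\<^sub>L ip x z o\<^sub>L ip u (xs n)) (\<xi> n)) (\<xi> n))
          \<longlonglongrightarrow> c * norm (theta act ip x y) * norm (theta act ip z u))"
proof -
  interpret hilbert_K_module act ip by fact
  obtain w :: 'e where "w \<noteq> 0" using nonzero by blast
  from norm_parallel_iff_basic_sequence[OF this module_map_theta module_map_theta, of x y z u]
  show ?thesis unfolding form_theta basic_at_iff .
qed

end
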